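(* Let $0<L<\infty$, let $G,B\in\mathbb{R}$ be constants with $G^2+B^2\neq0$, and let $\tilde p,\tilde q\in C^0[0,L]$. For each $n\in\{1,2,3,4\}$, consider the $n$-th order linear problem for $\bm{u}_n=(\theta_n,v_n,s_n,w_n)^\top$ on $[0,L]$ given in the context, namely the $n$-th system of linear ODEs (in which the functions of index less than $n$ are the solutions of the lower-order problems) together with the conditions $\theta_n(0)=0$, $v_n(0)=0$, $s_n(L)=0$, $w_n(L)=0$. Then this problem has a unique solution $\bm{u}_n$, and $\bm{u}_n\in C^1([0,L];\mathbb{R}^4)$.
   Context: $C^r[0,L]$ denotes the space of $r$-times continuously differentiable real-valued functions on $[0,L]$; $C^0[0,L]$ is the space of continuous functions; $C^1([0,L];\mathbb{R}^4)$ is the space of $\mathbb{R}^4$-valued functions all of whose components are in $C^1[0,L]$. Write $$h(x):=\frac{G\tilde p(x)+B\tilde q(x)}{G^2+B^2}.$$ The problems are defined recursively: the $n$-th problem uses the solutions of the problems of order lower than $n$ as given functions. Order 1: $$\frac{d\theta_1}{dx}=-s_1,\quad \frac{dv_1}{dx}=w_1,\quad \frac{ds_1}{dx}=\frac{B\tilde p(x)-G\tilde q(x)}{G^2+B^2},\quad \frac{dw_1}{dx}=-h(x).$$ Order 2: $$\frac{d\theta_2}{dx}=2v_1(x)s_1(x),\quad \frac{dv_2}{dx}=w_2,\quad \frac{ds_2}{dx}=0,\quad \frac{dw_2}{dx}=s_1(x)^2+h(x)v_1(x).$$ Order 3: $$\frac{d\theta_3}{dx}=4v_1(x)^2s_1(x)+\{2v_2(x)+v_1(x)^2\}s_1(x),\quad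 \frac{dv_3}{dx}=w_3,\quad \frac{ds_3}{dx}=0,\quad \frac{dw_3}{dx}=-3s_1(x)^2v_1(x)+h(x)v_2(x).$$ Order 4: $$\frac{d\theta_4}{dx}=-2v_1(x)\left[4v_1(x)^2s_1(x)+\{2v_2(x)+v_1(x)^2\}s_1(x)\right]-\{2v_2(x)+v_1(x)^2\}\cdot 2v_1(x)s_1(x)-2\{v_3(x)+v_1(x)v_2(x)\}\cdot(-s_1(x)),$$ $$\frac{dv_4}{dx}=w_4,\quad \frac{ds_4}{dx}=0,\quad \frac{dw_4}{dx}=-3s_1(x)^2v_2(x)+h(x)v_3(x).$$ In every case the conditions are $\theta_n(0)=v_n(0)=0$ and $s_n(L)=w_n(L)=0$. *)

theory Defs
  imports "HOL-Analysis.Analysis"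
begin

text \<open>States are vectors in \<open>real ^ 4\<close> whose components 1, 2, 3, 4 are
  \<open>\<theta>\<close>, \<open>v\<close>, \<open>s\<close>, \<open>w\<close>. The argument \<open>y\<close> of a right-hand side is the current state
  of the unknown; \<open>u1\<close>, \<open>u2\<close>, \<open>u3\<close> are the given lower-order solutions.\<close>

definition hfun :: "real \<Rightarrow> real \<Rightarrow> (real \<Rightarrow> real) \<Rightarrow> (real \<Rightarrow> real) \<Rightarrow> real \<Rightarrow> real" where
  "hfun G B p q x = (G * p x + B * q x) / (G\<^sup>2 + B\<^sup>2)"

definition rhs1 ::
  "real \<Rightarrow> real \<Rightarrow> (real \<Rightarrow> real) \<Rightarrow> (real \<Rightarrow> real) \<Rightarrow> real \<Rightarrow> real ^ 4 \<Rightarrow> real ^ 4" where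
  "rhs1 G B p q x y =
     vector [- (y $ 3), y $ 4, (B * p x - G * q x) / (G\<^sup>2 + B\<^sup>2), - hfun G B p q x]"

definition rhs2 ::
  "(real \<Rightarrow> real) \<Rightarrow> (real \<Rightarrow> real ^ 4) \<Rightarrow> real \<Rightarrow> real ^ 4 \<Rightarrow> real ^ 4" where
  "rhs2 h u1 x y =
     (let v1 = u1 x $ 2; s1 = u1 x $ 3
      in vector [2 * v1 * s1, y $ 4, 0, s1\<^sup>2 + h x * v1])"

definition rhs3 ::
  "(real \<Rightarrow> real) \<Rightarrow> (real \<Rightarrow> real ^ 4) \<Rightarrow> (real \<Rightarrow> real ^ 4)
    \<Rightarrow> real \<Rightarrow> real ^ 4 \<Rightarrow> real ^ 4" where
  "rhs3 h u1 u2 x y =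
     (let v1 = u1 x $ 2; s1 = u1 x $ 3; v2 = u2 x $ 2
      in vector [4 * v1\<^sup>2 * s1 + (2 * v2 + v1\<^sup>2) * s1,
                 y $ 4,
                 0,
                 - 3 * s1\<^sup>2 * v1 + h x * v2])"

definition rhs4 ::
  "(real \<Rightarrow> real) \<Rightarrow> (real \<Rightarrow> real ^ 4) \<Rightarrow> (real \<Rightarrow> real ^ 4) \<Rightarrow> (real \<Rightarrow> real ^ 4)
    \<Rightarrow> real \<Rightarrow> real ^ 4 \<Rightarrow> real ^ 4" where
  "rhs4 h u1 u2 u3 x y =
     (let v1 = u1 x $ 2; s1 = u1 x $ 3; v2 = u2 x $ 2; v3 = u3 x $ 2
      in vector [- 2 * v1 * (4 * v1\<^sup>2 * s1 + (2 * v2 + v1\<^sup>2) * s1)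
                   - (2 * v2 + v1\<^sup>2) * (2 * v1 * s1)
                   - 2 * (v3 + v1 * v2) * (- s1),
                 y $ 4,
                 0,
                 - 3 * s1\<^sup>2 * v2 + h x * v3])"

text \<open>Only orders 1 to 4 are meaningful; the order-\<open>n\<close> right-hand side uses \<open>u k\<close>
  for \<open>1 \<le> k < n\<close> only.\<close>

definition order_rhs ::
  "real \<Rightarrow> real \<Rightarrow> (real \<Rightarrow> real) \<Rightarrow> (real \<Rightarrow> real) \<Rightarrow> (nat \<Rightarrow> real \<Rightarrow> real ^ 4) \<Rightarrow> nat
    \<Rightarrow> real \<Rightarrow> real ^ 4 \<Rightarrow> real ^ 4" where
  "order_rhs G B p q u n =
     (if n = 1 then rhs1 G B p q
      else if n = 2 then rhs2 (hfun G B p q) (u 1)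
      else if n = 3 then rhs3 (hfun G B p q) (u 1) (u 2)
      else if n = 4 then rhs4 (hfun G B p q) (u 1) (u 2) (u 3)
      else undefined)"

text \<open>Classical solutions on \<open>[0, L]\<close>: differentiable, with one-sided derivatives at the
  end points. Continuity of the derivative is not required here.\<close>

definition solves_order ::
  "real \<Rightarrow> real \<Rightarrow> real \<Rightarrow> (real \<Rightarrow> real) \<Rightarrow> (real \<Rightarrow> real) \<Rightarrow> (nat \<Rightarrow> real \<Rightarrow> real ^ 4) \<Rightarrow> nat
    \<Rightarrow> (real \<Rightarrow> real ^ 4) \<Rightarrow> bool" where
  "solves_order L G B p q u n y \<longleftrightarrow>
     (\<forall>x\<in>{0..L}. (y has_vector_derivative order_rhs G B p q u n x (y x)) (at x within {0..L}))
     \<and> y 0 $ 1 = 0 \<and> y 0 $ 2 = 0 \<and> y L $ 3 = 0 \<and> y L $ 4 = 0"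

text \<open>The library's \<open>C1_differentiable_on\<close> takes two-sided derivatives at every point,
  which on a closed interval would constrain values outside of it; hence these variants
  relative to \<open>[a, b]\<close>.\<close>

definition C1_interval :: "real \<Rightarrow> real \<Rightarrow> (real \<Rightarrow> real) \<Rightarrow> bool" where
  "C1_interval a b f \<longleftrightarrow>
     (\<exists>f'. (\<forall>x\<in>{a..b}. (f has_real_derivative f' x) (at x within {a..b}))
           \<and> continuous_on {a..b} f')"

definition C1_interval_vec :: "real \<Rightarrow> real \<Rightarrow> (real \<Rightarrow> real ^ 4) \<Rightarrow> bool" where
  "C1_interval_vec a b f \<longleftrightarrow> (\<forall>i. C1_interval a b (\<lambda>x. f x $ i))"

end

(* All four orders share the triangular form
     theta' = c * s + a(x),  v' = w,  s' = b(x),  w' = d(x)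
   with c = -1 at order 1 and c = 0 afterwards, and with a, b, d continuous because they are
   polynomials in p, q and the lower-order solutions. So s and w are determined by one
   integration from L, and then theta and v by one integration from 0. *)
theory Submission
  imports Defs
begin

lemma vector_4:
  "(vector [x, y, z, w] :: 'a::zero ^ 4) $ 1 = x"
  "(vector [x, y, z, w] :: 'a::zero ^ 4) $ 2 = y"
  "(vector [x, y, z, w] :: 'a::zero ^ 4) $ 3 = z"
  "(vector [x, y, z, w] :: 'a::zero ^ 4) $ 4 = w"
  unfolding vector_def by simp_all

text \<open>Differentiability can be tested on inner products with the elements of
  \<open>Basis\<close>, which in \<open>real ^ 'n\<close> are the coordinate axes. This splits the
  vector ODE into four scalar ones.\<close>

lemma has_vector_derivative_vec_iff:
  fixes f :: "real \<Rightarrow> real ^ 'n"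
  shows "(f has_vector_derivative D) (at x within S) \<longleftrightarrow>
    (\<forall>i. ((\<lambda>t. f t $ i) has_real_derivative D $ i) (at x within S))"
proof -
  have "(f has_vector_derivative D) (at x within S) \<longleftrightarrow>
      (\<forall>i. ((\<lambda>t. f t $ i) has_derivative (\<lambda>h. h * D $ i)) (at x within S))"
    unfolding has_vector_derivative_def
    by (subst has_derivative_componentwise_within) (simp add: Basis_vec_def inner_axis)
  then show ?thesis
    by (simp add: has_field_derivative_def mult_commute_abs)
qed

text \<open>Any antiderivative, shifted by its value at \<open>c\<close>, will do. The base point is
  kept free because \<open>s\<close> and \<open>w\<close> are anchored at \<open>L\<close>, while
  \<open>\<theta>\<close> and \<open>v\<close> are anchored at \<open>0\<close>.\<close>

lemma antiderivative_vanishing_at: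
  fixes f :: "real \<Rightarrow> real"
  assumes "continuous_on {a..b} f" and "c \<in> {a..b}"
  obtains F where "F c = 0"
    and "\<And>x. x \<in> {a..b} \<Longrightarrow> (F has_real_derivative f x) (at x within {a..b})"
proof -
  obtain F where F: "\<And>x. x \<in> {a..b} \<Longrightarrow> (F has_real_derivative f x) (at x within {a..b})"
    using antiderivative_continuous[OF assms(1)]
    by (auto simp: has_real_derivative_iff_has_vector_derivative)
  have "((\<lambda>x. F x - F c) has_real_derivative f x) (at x within {a..b})" if "x \<in> {a..b}" for x
    using F[OF that] by (auto intro!: derivative_eq_intros)
  then show thesis
    by (intro that[of "\<lambda>x. F x - F c"]) auto
qed

text \<open>The difference has zero derivative on an interval, so it is constant, and its value at
  \<open>c\<close> is zero.\<close>

lemma antiderivative_unique: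
  fixes F H :: "real \<Rightarrow> real"
  assumes "\<And>x. x \<in> {a..b} \<Longrightarrow> (F has_real_derivative f x) (at x within {a..b})"
    and "\<And>x. x \<in> {a..b} \<Longrightarrow> (H has_real_derivative f x) (at x within {a..b})"
    and "c \<in> {a..b}" "F c = H c" "x \<in> {a..b}"
  shows "F x = H x"
proof -
  have "((\<lambda>x. F x - H x) has_real_derivative 0) (at t within {a..b})" if "t \<in> {a..b}" for t
    using DERIV_diff[OF assms(1,2)] that by fastforce
  then have "\<exists>k. \<forall>t\<in>{a..b}. F t - H t = k"
    by (intro has_field_derivative_zero_constant) auto
  then show ?thesis
    using assms(3-5) by (metis diff_self eq_iff_diff_eq_0)
qed


lemma C1_intervalI:
  assumes "\<And>x. x \<in> {a..b} \<Longrightarrow> (f has_real_derivative f' x) (at x within {a..b})"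
    and "continuous_on {a..b} f'"
  shows "C1_interval a b f"
  using assms unfolding C1_interval_def by blast

text \<open>The common form of all four problems. Uniqueness is asserted on \<open>{0..L}\<close>
  only: functions are total here, and the problem does not constrain values outside the
  interval.\<close>

lemma linear_bvp_unique_solution:
  fixes a b d :: "real \<Rightarrow> real" and c L :: real
  assumes "0 \<le> L"
    and "continuous_on {0..L} a" "continuous_on {0..L} b" "continuous_on {0..L} d"
  defines "sol \<equiv> \<lambda>y :: real \<Rightarrow> real ^ 4.
    (\<forall>x\<in>{0..L}. (y has_vector_derivative vector [c * y x $ 3 + a x, y x $ 4, b x, d x])
       (at x within {0..L}))
    \<and> y 0 $ 1 = 0 \<and> y 0 $ 2 = 0 \<and> y L $ 3 = 0 \<and> y L $ 4 = 0"
  shows "\<exists>y. sol y \<and> C1_interval_vec 0 L y \<and> (\<forall>z. sol z \<longrightarrow> (\<forall>x\<in>{0..L}. z x = y x))"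
proof -
  have ends: "0 \<in> {0..L}" "L \<in> {0..L}"
    using \<open>0 \<le> L\<close> by auto
  obtain s where s: "s L = 0"
      "\<And>x. x \<in> {0..L} \<Longrightarrow> (s has_real_derivative b x) (at x within {0..L})"
    using antiderivative_vanishing_at[OF assms(3) ends(2)] by blast
  obtain w where w: "w L = 0"
      "\<And>x. x \<in> {0..L} \<Longrightarrow> (w has_real_derivative d x) (at x within {0..L})"
    using antiderivative_vanishing_at[OF assms(4) ends(2)] by blast
  \<comment> \<open>The next two facts serve twice: they allow the second round of integrations, and
    they are the continuity of the derivatives of \<open>v\<close> and \<open>\<theta>\<close>
    required for C1.\<close>
  have cont_w: "continuous_on {0..L} w"
    by (rule DERIV_continuous_on[OF w(2)])
  have cont_1: "continuous_on {0..L} (\<lambda>x. c * s x + a x)"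
    by (intro continuous_intros assms DERIV_continuous_on[OF s(2)])
  obtain v where v: "v 0 = 0"
      "\<And>x. x \<in> {0..L} \<Longrightarrow> (v has_real_derivative w x) (at x within {0..L})"
    using antiderivative_vanishing_at[OF cont_w ends(1)] by blast
  obtain \<theta> where \<theta>: "\<theta> 0 = 0"
      "\<And>x. x \<in> {0..L} \<Longrightarrow> (\<theta> has_real_derivative c * s x + a x) (at x within {0..L})"
    using antiderivative_vanishing_at[OF cont_1 ends(1)] by blast
  define y :: "real \<Rightarrow> real ^ 4" where "y x = vector [\<theta> x, v x, s x, w x]" for x
  have sol_iff: "sol z \<longleftrightarrow>
    (\<forall>x\<in>{0..L}. ((\<lambda>t. z t $ 1) has_real_derivative c * z x $ 3 + a x) (at x within {0..L})
      \<and> ((\<lambda>t. z t $ 2) has_real_derivative z x $ 4) (at x within {0..L})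
      \<and> ((\<lambda>t. z t $ 3) has_real_derivative b x) (at x within {0..L})
      \<and> ((\<lambda>t. z t $ 4) has_real_derivative d x) (at x within {0..L}))
    \<and> z 0 $ 1 = 0 \<and> z 0 $ 2 = 0 \<and> z L $ 3 = 0 \<and> z L $ 4 = 0" for z
    by (simp add: sol_def has_vector_derivative_vec_iff forall_4 vector_4)
  have "sol y"
    using s w v \<theta> by (simp add: sol_iff y_def vector_4)
  moreover have "C1_interval 0 L \<theta>" "C1_interval 0 L v" "C1_interval 0 L s" "C1_interval 0 L w"
    by (rule C1_intervalI[OF \<theta>(2) cont_1] C1_intervalI[OF v(2) cont_w]
        C1_intervalI[OF s(2) assms(3)] C1_intervalI[OF w(2) assms(4)]; assumption)+
  then have "C1_interval_vec 0 L y"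
    by (simp add: C1_interval_vec_def forall_4 y_def vector_4)
  moreover have "z x = y x" if z: "sol z" and x: "x \<in> {0..L}" for z x
  proof -
    note z' = z[unfolded sol_iff]
    \<comment> \<open>The derivatives of components 3 and 4 do not involve \<open>z\<close>, so
      these components are settled first. Replacing them by \<open>s\<close> and \<open>w\<close>
      gives components 1 and 2 the same derivatives as \<open>\<theta>\<close> and
      \<open>v\<close>.\<close>
    have 3: "z t $ 3 = s t" if "t \<in> {0..L}" for t
      using z' s(1) by (intro antiderivative_unique[OF _ s(2) ends(2) _ that]) auto
    have 4: "z t $ 4 = w t" if "t \<in> {0..L}" for t
      using z' w(1) by (intro antiderivative_unique[OF _ w(2) ends(2) _ that]) auto
    have "z x $ 1 = \<theta> x"
      using z' \<theta>(1) 3 by (intro antiderivative_unique[OF _ \<theta>(2) ends(1) _ x]) auto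
    moreover have "z x $ 2 = v x"
      using z' v(1) 4 by (intro antiderivative_unique[OF _ v(2) ends(1) _ x]) auto
    ultimately show ?thesis
      using 3 4 x by (simp add: y_def vec_eq_iff forall_4 vector_4)
  qed
  ultimately show ?thesis
    by blast
qed

lemma solves_order_continuous_on:
  assumes "solves_order L G B p q u n y"
  shows "continuous_on {0..L} y"
  by (rule continuous_on_vector_derivative) (use assms in \<open>auto simp: solves_order_def\<close>)

theorem theorem3p2:
  fixes L G B :: real and p q :: "real \<Rightarrow> real"
    and n :: nat and u :: "nat \<Rightarrow> real \<Rightarrow> real ^ 4"
  assumes "0 < L"
    and "G\<^sup>2 + B\<^sup>2 \<noteq> 0"
    and "continuous_on {0..L} p"
    and "continuous_on {0..L} q"
    and "n \<in> {1, 2, 3, 4}"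
    and "\<forall>k\<in>{1..<n}. solves_order L G B p q u k (u k)"
  shows "\<exists>y. solves_order L G B p q u n y
             \<and> C1_interval_vec 0 L y
             \<and> (\<forall>z. solves_order L G B p q u n z \<longrightarrow> (\<forall>x\<in>{0..L}. z x = y x))"
proof -
  \<comment> \<open>Being a solution already makes each \<open>u k\<close> continuous, so the
    coefficients built from them are continuous too. At order 1 the range of \<open>k\<close> is
    empty.\<close>
  have u_cont: "continuous_on {0..L} (u k)" if "1 \<le> k" "k < n" for k
    using assms(6) that by (auto intro: solves_order_continuous_on)
  have h_cont: "continuous_on {0..L} (hfun G B p q)"
    unfolding hfun_def[abs_def] using assms(2) by (intro continuous_intros assms(3,4)) auto
  \<comment> \<open>The unknown \<open>y\<close> enters only through \<open>c * y $ 3\<close> and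
    \<open>y $ 4\<close>; everything else is a given function of \<open>x\<close>. The witnesses
    below are read off from the right-hand sides, with \<open>c\<close> in third place.\<close>
  have "\<exists>a b c d. continuous_on {0..L} a \<and> continuous_on {0..L} b \<and> continuous_on {0..L} d \<and>
      order_rhs G B p q u n = (\<lambda>x y. vector [c * y $ 3 + a x, y $ 4, b x, d x])"
    (is "\<exists>a b c d. ?P a b c d")
  proof -
    consider "n = 1" | "n = 2" | "n = 3" | "n = 4"
      using assms(5) by blast
    then show ?thesis
    proof cases
      case 1
      then have "?P (\<lambda>_. 0) (\<lambda>x. (B * p x - G * q x) / (G\<^sup>2 + B\<^sup>2)) (- 1) (\<lambda>x. - hfun G B p q x)"
        using assms(2)
        by (auto simp: order_rhs_def rhs1_def fun_eq_iff intro!: continuous_intros assms(3,4) h_cont)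
      then show ?thesis by blast
    next
      case 2
      let ?v1 = "\<lambda>x. u 1 x $ 2" and ?s1 = "\<lambda>x. u 1 x $ 3"
      have "?P (\<lambda>x. 2 * ?v1 x * ?s1 x) (\<lambda>_. 0) 0
          (\<lambda>x. (?s1 x)\<^sup>2 + hfun G B p q x * ?v1 x)"
        using 2
        by (auto simp: order_rhs_def rhs2_def Let_def fun_eq_iff
            simp del: One_nat_def intro!: continuous_intros h_cont u_cont)
      then show ?thesis by blast
    next
      case 3
      let ?v1 = "\<lambda>x. u 1 x $ 2" and ?s1 = "\<lambda>x. u 1 x $ 3" and ?v2 = "\<lambda>x. u 2 x $ 2"
      have "?P (\<lambda>x. 4 * (?v1 x)\<^sup>2 * ?s1 x + (2 * ?v2 x + (?v1 x)\<^sup>2) * ?s1 x) (\<lambda>_. 0) 0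
          (\<lambda>x. - 3 * (?s1 x)\<^sup>2 * ?v1 x + hfun G B p q x * ?v2 x)"
        using 3
        by (auto simp: order_rhs_def rhs3_def Let_def fun_eq_iff
            simp del: One_nat_def intro!: continuous_intros h_cont u_cont)
      then show ?thesis by blast
    next
      case 4
      let ?v1 = "\<lambda>x. u 1 x $ 2" and ?s1 = "\<lambda>x. u 1 x $ 3"
        and ?v2 = "\<lambda>x. u 2 x $ 2" and ?v3 = "\<lambda>x. u 3 x $ 2"
      have "?P (\<lambda>x. - 2 * ?v1 x * (4 * (?v1 x)\<^sup>2 * ?s1 x + (2 * ?v2 x + (?v1 x)\<^sup>2) * ?s1 x)
            - (2 * ?v2 x + (?v1 x)\<^sup>2) * (2 * ?v1 x * ?s1 x)
            - 2 * (?v3 x + ?v1 x * ?v2 x) * (- ?s1 x)) (\<lambda>_. 0) 0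
          (\<lambda>x. - 3 * (?s1 x)\<^sup>2 * ?v2 x + hfun G B p q x * ?v3 x)"
        using 4
        by (auto simp: order_rhs_def rhs4_def Let_def fun_eq_iff
            simp del: One_nat_def intro!: continuous_intros h_cont u_cont)
      then show ?thesis by blast
    qed
  qed
  then obtain a b c d where "?P a b c d"
    by blast
  \<comment> \<open>Since the right-hand sides are equal as functions of both \<open>x\<close> and
    \<open>y\<close>, \<open>solves_order\<close> becomes exactly the predicate \<open>sol\<close>
    of the linear problem.\<close>
  then show ?thesis
    unfolding solves_order_def
    using linear_bvp_unique_solution[of L a b d c] \<open>0 < L\<close> by simp
qed

end
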